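(* Let $P\subset\mathbb{R}^3$ be the set of all triples $(x_3,x_2,x_1)$ of real numbers satisfying $x_3\leq 4/9$, $x_2\leq 1/2$, $x_3+x_1\leq 2/3$, $x_3+\tfrac32 x_2\leq 1$, $x_3+x_2+x_1\leq 1$ and $x_3+\tfrac16 x_2\leq 1/2$. Let $(\alpha,\beta,\gamma)$ be an element of $P$ (so $x_3=\alpha$, $x_2=\beta$, $x_1=\gamma$). \begin{enumerate} \item If $\alpha\geq 0$ then $\nu(G)\geq \alpha n_3+\beta n_2+\gamma n_1-1$ for every connected subcubic graph $G$. \item If $\alpha<0$ then $\nu(G)\geq \alpha n_3+\beta n_2+\gamma n_1-(2|\alpha|+1)$ for every connected subcubic graph $G$. \end{enumerate}
   Context: Graphs are finite and simple; connected graphs are nonempty. A graph is subcubic if its maximum degree is at most three. For a graph $G$, $\nu(G)$ denotes the maximum size (number of edges) of a matching in $G$, and $n_i$ denotes the number of vertices of degree $i$ in $G$. *)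

theory Defs
  imports Complex_Main
begin

text \<open>
  A graph is given by its vertex set \<open>V\<close> and its set \<open>E\<close> of edges, an edge being
  the set of its two ends.
\<close>

definition simple_graph :: "'a set \<Rightarrow> 'a set set \<Rightarrow> bool" where
  "simple_graph V E \<longleftrightarrow> finite V \<and> (\<forall>e\<in>E. e \<subseteq> V \<and> card e = 2)"

definition adj_rel :: "'a set set \<Rightarrow> ('a \<times> 'a) set" where
  "adj_rel E = {(u, v). {u, v} \<in> E}"

definition connected_graph :: "'a set \<Rightarrow> 'a set set \<Rightarrow> bool" where
  "connected_graph V E \<longleftrightarrow>
     simple_graph V E \<and> V \<noteq> {} \<and> (\<forall>u\<in>V. \<forall>v\<in>V. (u, v) \<in> (adj_rel E)\<^sup>*)"

definition vertex_degree :: "'a set set \<Rightarrow> 'a \<Rightarrow> nat" where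
  "vertex_degree E v = card {e \<in> E. v \<in> e}"

definition subcubic :: "'a set \<Rightarrow> 'a set set \<Rightarrow> bool" where
  "subcubic V E \<longleftrightarrow> (\<forall>v\<in>V. vertex_degree E v \<le> 3)"

definition num_degree :: "'a set \<Rightarrow> 'a set set \<Rightarrow> nat \<Rightarrow> nat" where
  "num_degree V E i = card {v \<in> V. vertex_degree E v = i}"

definition matching :: "'a set set \<Rightarrow> 'a set set \<Rightarrow> bool" where
  "matching E M \<longleftrightarrow> M \<subseteq> E \<and> pairwise disjnt M"

definition matching_number :: "'a set set \<Rightarrow> nat" where
  "matching_number E = Max (card ` {M. matching E M})"

text \<open>The components of a triple are \<open>(x3, x2, x1)\<close>, in this order.\<close>

definition polyP :: "(real \<times> real \<times> real) set" where
  "polyP = {(x3, x2, x1).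
     x3 \<le> 4/9 \<and> x2 \<le> 1/2 \<and> x3 + x1 \<le> 2/3 \<and> x3 + 3/2 * x2 \<le> 1 \<and>
     x3 + x2 + x1 \<le> 1 \<and> x3 + 1/6 * x2 \<le> 1/2}"

end

theory Submission
  imports Defs
begin

text \<open>
  The Tutte--Berge formula provides a set \<open>S\<close> of vertices such that the number of odd components
  of \<open>G - S\<close> is at least \<open>n - 2\<nu> + |S|\<close>, where \<open>n\<close> is the number of vertices and \<open>\<nu>\<close> the
  matching number. An upper bound on the number of odd components is therefore
  a lower bound on \<open>\<nu>\<close>. Each vertex receives a weight that depends on its degree; an odd component
  with few edges to \<open>S\<close> has large weight, for parity reasons and because a component with one or
  three vertices has few edges, while at most \<open>3|S|\<close> edges leave \<open>S\<close>. Adding up the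
  weights (\<open>weighted_odd_classes_bound\<close>) yields three inequalities, which correspond to the vertices
  \<open>(4/9, 1/3, 2/9)\<close>, \<open>(7/16, 3/8, 3/16)\<close> and \<open>(1/4, 1/2, 1/4)\<close> of the polytope:
  \<open>4 n\<^sub>3 + 3 n\<^sub>2 + 2 n\<^sub>1 \<le> 9 \<nu> + 1\<close>, \<open>7 n\<^sub>3 + 6 n\<^sub>2 + 3 n\<^sub>1 \<le> 16 \<nu> + 2\<close> and
  \<open>n\<^sub>3 + 2 n\<^sub>2 + n\<^sub>1 \<le> 4 \<nu> + 2\<close>. The first one also uses that contracting the components
  of \<open>G - S\<close> leaves a connected graph, so that the number of components is at most one more than
  the number of edges meeting \<open>S\<close>, minus \<open>|S|\<close>.

  The unbounded direction \<open>(-1, 0, 1)\<close> of the polytope is governed by \<open>n\<^sub>1 \<le> n\<^sub>3 + 2\<close>, which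
  holds since a connected graph has at least \<open>n - 1\<close> edges. For \<open>\<alpha> \<ge> 0\<close> these four inequalities
  imply the bound by linearity in \<open>\<alpha>\<close> and in \<open>\<beta>\<close>. For \<open>\<alpha> < 0\<close> the point \<open>(0, \<beta>, \<gamma> + \<alpha>)\<close> still
  lies in the polytope, and moving from it to \<open>(\<alpha>, \<beta>, \<gamma>)\<close> adds \<open>|\<alpha>| (n\<^sub>1 - n\<^sub>3) \<le> 2|\<alpha>|\<close>.

  The inequality of the Tutte--Berge formula that is needed is proved by induction on the number of
  vertices. A vertex covered by all maximum matchings is moved to \<open>S\<close>. If there is no
  such vertex, Gallai's lemma says that ``no maximum matching misses both \<open>u\<close> and \<open>v\<close>'' is a transitive
  relation; its classes serve as components, with \<open>S\<close> empty.
\<close>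

section \<open>Matchings\<close>

text \<open>Maximum refers to cardinality, not to inclusion.\<close>

definition maximum_matching :: "'a set set \<Rightarrow> 'a set set \<Rightarrow> bool" where
  "maximum_matching E M \<longleftrightarrow> matching E M \<and> card M = matching_number E"

lemma simple_graph_finite_edges:
  assumes "simple_graph V E"
  shows "finite E"
proof -
  have "E \<subseteq> Pow V" "finite V"
    using assms by (auto simp: simple_graph_def)
  then show ?thesis
    by (meson finite_Pow_iff finite_subset)
qed

lemma finite_matchings:
  assumes "finite E"
  shows "finite {M. matching E M}"
  by (rule finite_subset[of _ "Pow E"]) (use assms in \<open>auto simp: matching_def\<close>)

lemma card_matching_le:
  assumes "finite E" "matching E M"
  shows "card M \<le> matching_number E"
  unfolding matching_number_def
  using assms finite_matchings[OF assms(1)] by (intro Max_ge) auto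

lemma ex_maximum_matching:
  assumes "finite E"
  shows "\<exists>M. maximum_matching E M"
proof -
  have "matching E {}"
    by (simp add: matching_def)
  then have "matching_number E \<in> card ` {M. matching E M}"
    unfolding matching_number_def
    using finite_matchings[OF assms] by (intro Max_in) auto
  then show ?thesis
    by (auto simp: maximum_matching_def)
qed

lemma card_Union_matching:
  assumes "simple_graph V E" "matching E M"
  shows "card (\<Union>M) = 2 * card M"
proof -
  have c: "card e = 2" if "e \<in> M" for e
    using assms that by (auto simp: matching_def simple_graph_def)
  have "card (\<Union>M) = sum card M"
    using assms(2) c
    by (intro card_Union_disjoint) (auto simp: matching_def intro: card_ge_0_finite)
  then show ?thesis
    using c by simp
qed

lemma card_Union_maximum_matching:
  assumes "simple_graph V E" "maximum_matching E M"
  shows "card (\<Union>M) = 2 * matching_number E"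
  using assms card_Union_matching by (fastforce simp: maximum_matching_def)

lemma matching_Union_subset:
  assumes "simple_graph V E" "matching E M"
  shows "\<Union>M \<subseteq> V"
  using assms by (auto simp: matching_def simple_graph_def)

lemma matching_insert:
  assumes "matching E M" "e \<in> E" "e \<inter> \<Union>M = {}"
  shows "matching E (insert e M)"
  using assms by (auto simp: matching_def pairwise_insert disjnt_def)

lemma matching_edge_unique:
  assumes "matching E M" "e \<in> M" "f \<in> M" "x \<in> e" "x \<in> f"
  shows "e = f"
  using assms by (auto simp: matching_def pairwise_def disjnt_def)

lemma maximum_matching_misses_no_edge:
  assumes "finite E" "maximum_matching E M" "e \<in> E" "e \<noteq> {}"
  shows "e \<inter> \<Union>M \<noteq> {}"
proof
  assume "e \<inter> \<Union>M = {}"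
  moreover from this have "e \<notin> M"
    using assms(4) by auto
  moreover have "finite M"
    using assms by (meson finite_subset matching_def maximum_matching_def)
  moreover have "matching E M" "card M = matching_number E"
    using assms(2) by (auto simp: maximum_matching_def)
  ultimately show False
    using card_matching_le[OF assms(1) matching_insert[of E M e]] assms(3) by auto
qed

section \<open>A barrier attaining the Tutte--Berge bound\<close>

text \<open>
  Gallai's lemma, in contrapositive form: if some maximum matching misses both \<open>u\<close> and \<open>v\<close>, then for
  every \<open>t\<close> that can be missed, some maximum matching misses \<open>t\<close> together with \<open>u\<close> or \<open>v\<close>.
\<close>

lemma missed_pairs_transitive:
  assumes G: "simple_graph V E"
    and M: "maximum_matching E M" and uv: "u \<in> V - \<Union>M" "v \<in> V - \<Union>M" "u \<noteq> v"
    and t: "\<exists>N. maximum_matching E N \<and> t \<notin> \<Union>N"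
  shows "\<exists>N. maximum_matching E N \<and> t \<notin> \<Union>N \<and> (u \<notin> \<Union>N \<or> v \<notin> \<Union>N)"
proof (rule ccontr)
  assume no: "\<not> ?thesis"
  have finE: "finite E"
    using G by (rule simple_graph_finite_edges)
  have fin: "finite N" "finite (\<Union>N)" if "maximum_matching E N" for N
    using that finE matching_Union_subset[OF G, of N] G
    by (auto simp: maximum_matching_def matching_def simple_graph_def
        intro: finite_subset)
  \<comment> \<open>Among the maximum matchings missing \<open>t\<close>, take one that agrees with \<open>M\<close> as much as possible;
    exchanging one edge of \<open>N\<close> for one of \<open>M\<close> will contradict this choice.\<close>
  obtain N where N: "maximum_matching E N" "t \<notin> \<Union>N"
    and best: "\<And>N'. maximum_matching E N' \<Longrightarrow> t \<notin> \<Union>N' \<Longrightarrow> card (M \<inter> N') \<le> card (M \<inter> N)"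
  proof -
    have "\<forall>N'. maximum_matching E N' \<and> t \<notin> \<Union>N' \<longrightarrow> card (M \<inter> N') \<le> card M"
      using fin[OF M] by (simp add: card_mono)
    then show ?thesis
      using that t ex_has_greatest_nat[of "\<lambda>N'. maximum_matching E N' \<and> t \<notin> \<Union>N'" _
          "\<lambda>N'. card (M \<inter> N')" "Suc (card M)"]
      by (metis (no_types, lifting) less_Suc_eq_le)
  qed
  \<comment> \<open>\<open>M\<close> and \<open>N\<close> cover equally many vertices, and \<open>N\<close> covers \<open>u\<close> and \<open>v\<close>; so \<open>N\<close> misses at
    least two vertices covered by \<open>M\<close>, one of which is not \<open>t\<close>.\<close>
  have "{u, v} \<subseteq> \<Union>N - \<Union>M"
    using no N uv by auto
  then have "2 \<le> card (\<Union>N - \<Union>M)"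
    using card_mono[of "\<Union>N - \<Union>M" "{u, v}"] fin[OF N(1)] uv(3) by auto
  moreover have "card (\<Union>N - \<Union>M) = card (\<Union>M - \<Union>N)"
    using card_Union_maximum_matching[OF G M] card_Union_maximum_matching[OF G N(1)]
      fin[OF M] fin[OF N(1)]
    by (metis card_le_sym_Diff le_antisym order_refl)
  ultimately have "\<not> \<Union>M - \<Union>N \<subseteq> {t}"
    using card_mono[of "{t}" "\<Union>M - \<Union>N"] by auto
  then obtain x e where x: "x \<notin> \<Union>N" "x \<noteq> t" "x \<in> e" "e \<in> M"
    by auto
  have eE: "e \<in> E" and "card e = 2"
    using x M G by (auto simp: maximum_matching_def matching_def simple_graph_def)
  then obtain y where y: "e = {x, y}" "x \<noteq> y"
    using x(3) by (metis card_2_iff doubleton_eq_iff insertE singletonD)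
  have "y \<in> \<Union>N"
    using maximum_matching_misses_no_edge[OF finE N(1) eE] x y by auto
  then obtain f where f: "f \<in> N" "y \<in> f"
    by auto
  have mN: "matching E N" and mM: "matching E M"
    using M N by (auto simp: maximum_matching_def)
  let ?N = "insert e (N - {f})"
  have "e \<notin> N"
    using x by auto
  have "y \<notin> \<Union>(N - {f})"
    using matching_edge_unique[OF mN _ f(1) _ f(2)] by auto
  then have "matching E ?N"
    using x y mN eE by (intro matching_insert) (auto simp: matching_def pairwise_def)
  moreover have "card ?N = card N"
    using \<open>e \<notin> N\<close> f fin[OF N(1)]
    by (simp add: card.insert_remove card_Diff_singleton) (metis card_gt_0_iff empty_iff Suc_pred)
  ultimately have "maximum_matching E ?N"
    using N by (simp add: maximum_matching_def)
  moreover have "t \<notin> \<Union>?N"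
    using N(2) x(2) y \<open>y \<in> \<Union>N\<close> by auto
  moreover have "f \<notin> M"
    using matching_edge_unique[OF mM x(4) _ _ f(2)] f x y by auto
  then have "M \<inter> ?N = insert e (M \<inter> N)"
    using x by auto
  then have "card (M \<inter> ?N) = Suc (card (M \<inter> N))"
    using \<open>e \<notin> N\<close> fin[OF M] by auto
  ultimately show False
    using best[of ?N] by auto
qed

text \<open>
  A set \<open>S\<close> of vertices together with a labelling \<open>c\<close> that is constant along the edges avoiding
  \<open>S\<close>. The classes of \<open>c\<close> on \<open>V - S\<close> are unions of components of \<open>G - S\<close>; they need not be
  connected. The values of \<open>c\<close> on \<open>S\<close> are irrelevant.
\<close>

definition barrier :: "'a set \<Rightarrow> 'a set set \<Rightarrow> 'a set \<Rightarrow> ('a \<Rightarrow> 'b) \<Rightarrow> bool" where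
  "barrier V E S c \<longleftrightarrow> S \<subseteq> V \<and> (\<forall>u v. {u, v} \<in> E \<longrightarrow> u \<notin> S \<longrightarrow> v \<notin> S \<longrightarrow> c u = c v)"

text \<open>The labels of the classes in \<open>V - S\<close> with an odd number of vertices.\<close>

definition odd_classes :: "'a set \<Rightarrow> 'a set \<Rightarrow> ('a \<Rightarrow> 'b) \<Rightarrow> 'b set" where
  "odd_classes V S c = {l \<in> c ` (V - S). odd (card {v \<in> V - S. c v = l})}"

text \<open>
  If every vertex is missed by some maximum matching, the empty set is a barrier: a maximum
  matching misses at most one vertex of each class of Gallai's relation, and since no edge joins
  different classes, a class in which it misses a vertex is odd.
\<close>

lemma gallai_barrier:
  assumes G: "simple_graph V E"
    and missed: "\<And>v. v \<in> V \<Longrightarrow> \<exists>M. maximum_matching E M \<and> v \<notin> \<Union>M"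
  shows "\<exists>c :: 'a \<Rightarrow> 'a set. barrier V E {} c \<and>
           card V \<le> 2 * matching_number E + card (odd_classes V {} c)"
proof -
  have finE: "finite E" and finV: "finite V"
    using G simple_graph_finite_edges by (auto simp: simple_graph_def)
  define R where "R u v \<longleftrightarrow> u \<in> V \<and> v \<in> V \<and>
      (u = v \<or> \<not> (\<exists>M. maximum_matching E M \<and> u \<notin> \<Union>M \<and> v \<notin> \<Union>M))" for u v
  have in_V: "R u v \<Longrightarrow> u \<in> V" for u v
    by (simp add: R_def)
  have refl: "R v v" if "v \<in> V" for v
    using that by (simp add: R_def)
  have sym: "R u v \<Longrightarrow> R v u" for u v
    by (auto simp: R_def)
  have trans: "R u w" if uv: "R u v" and vw: "R v w" for u v w
  proof (rule ccontr)
    assume n: "\<not> R u w"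
    then obtain M where "maximum_matching E M" "u \<in> V - \<Union>M" "w \<in> V - \<Union>M" "u \<noteq> w"
      using uv vw unfolding R_def by auto
    moreover have "v \<in> V"
      using uv by (simp add: R_def)
    ultimately obtain N where "maximum_matching E N" "v \<notin> \<Union>N" "u \<notin> \<Union>N \<or> w \<notin> \<Union>N"
      using missed_pairs_transitive[OF G] missed by metis
    then show False
      using uv vw n unfolding R_def by blast
  qed
  define c where "c v = {u. R u v}" for v
  have c_eq: "c u = c v \<longleftrightarrow> R u v" if "u \<in> V" "v \<in> V" for u v
    using refl sym trans that unfolding c_def by blast
  have edge: "R u v" if "{u, v} \<in> E" for u v
    using maximum_matching_misses_no_edge[OF finE _ that] that G
    by (auto simp: R_def simple_graph_def)
  obtain M where M: "maximum_matching E M"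
    using ex_maximum_matching[OF finE] by auto
  then have mM: "matching E M"
    by (simp add: maximum_matching_def)
  have sub: "\<Union>M \<subseteq> V"
    by (rule matching_Union_subset[OF G mM])
  have "inj_on c (V - \<Union>M)"
    using c_eq M by (auto simp: inj_on_def R_def)
  moreover have "c ` (V - \<Union>M) \<subseteq> odd_classes V {} c"
  proof
    fix l assume "l \<in> c ` (V - \<Union>M)"
    then obtain u where u: "l = c u" "u \<in> V" "u \<notin> \<Union>M"
      by auto
    have "{v \<in> V. c v = c u} = {v. R v u}"
      using c_eq u(2) in_V by blast
    then have cls: "{v \<in> V. c v = l} = c u"
      by (simp add: u(1) c_def)
    let ?M = "{e \<in> M. e \<subseteq> c u}"
    have "c u \<subseteq> insert u (\<Union>?M)"
    proof
      fix v assume v: "v \<in> c u"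
      show "v \<in> insert u (\<Union>?M)"
      proof (cases "v = u")
        case False
        then obtain e where e: "e \<in> M" "v \<in> e"
          using v u M by (auto simp: c_def R_def)
        then have eE: "e \<in> E" and "card e = 2"
          using mM G by (auto simp: matching_def simple_graph_def)
        then obtain w where w: "e = {v, w}"
          using e(2) by (metis card_2_iff doubleton_eq_iff insertE singletonD)
        then have "w \<in> c u"
          using edge[of w v] eE v trans by (auto simp: c_def insert_commute)
        then show ?thesis
          using w e v by auto
      qed simp
    qed
    then have "c u = insert u (\<Union>?M)"
      using refl u(2) by (auto simp: c_def)
    moreover have "matching E ?M"
      using mM by (auto simp: matching_def pairwise_def)
    then have "card (\<Union>?M) = 2 * card ?M"
      by (rule card_Union_matching[OF G])
    moreover have "u \<notin> \<Union>?M"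
      using u by auto
    moreover have "finite (\<Union>?M)"
      by (rule finite_subset[of _ V]) (use sub finV in auto)
    ultimately have "card (c u) = Suc (2 * card ?M)"
      by (metis card_insert_disjoint)
    then have "odd (card (c u))"
      by simp
    then show "l \<in> odd_classes V {} c"
      using u cls by (auto simp: odd_classes_def)
  qed
  moreover have "finite (odd_classes V {} c)"
    using finV by (simp add: odd_classes_def)
  ultimately have "card (V - \<Union>M) \<le> card (odd_classes V {} c)"
    by (metis card_image card_mono)
  moreover have "card V = card (V - \<Union>M) + 2 * matching_number E"
    using card_Union_maximum_matching[OF G M] sub finV
    by (metis card_Diff_subset card_mono finite_subset le_add_diff_inverse2)
  moreover have "barrier V E {} c"
    using edge c_eq by (auto simp: barrier_def R_def)
  ultimately show ?thesis
    by auto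
qed

text \<open>The nontrivial inequality of the Tutte--Berge formula.\<close>

lemma tutte_berge_barrier:
  fixes V :: "'a set"
  assumes "simple_graph V E"
  shows "\<exists>S (c :: 'a \<Rightarrow> 'a set). barrier V E S c \<and>
           card V + card S \<le> 2 * matching_number E + card (odd_classes V S c)"
  using assms
proof (induction "card V" arbitrary: V E rule: less_induct)
  case less
  have finE: "finite E" and finV: "finite V"
    using less.prems simple_graph_finite_edges by (auto simp: simple_graph_def)
  show ?case
  proof (cases "\<forall>v\<in>V. \<exists>M. maximum_matching E M \<and> v \<notin> \<Union>M")
    case True
    then show ?thesis
      using gallai_barrier[OF less.prems] by (metis add.right_neutral card.empty)
  next
    case False
    then obtain v where v: "v \<in> V" "\<And>M. maximum_matching E M \<Longrightarrow> v \<in> \<Union>M"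
      by auto
    \<comment> \<open>Deleting \<open>v\<close> decreases the matching number, so \<open>v\<close> can be added to a barrier of the rest.\<close>
    let ?V = "V - {v}" and ?E = "{e \<in> E. v \<notin> e}"
    have G': "simple_graph ?V ?E"
      using less.prems by (auto simp: simple_graph_def)
    have cV: "card V = Suc (card ?V)"
      using v finV by (metis card_Suc_Diff1)
    then obtain S and c :: "'a \<Rightarrow> 'a set" where S: "barrier ?V ?E S c"
      "card ?V + card S \<le> 2 * matching_number ?E + card (odd_classes ?V S c)"
      using less.hyps[OF _ G'] by auto
    have "matching_number ?E < matching_number E"
    proof -
      obtain M where M: "maximum_matching ?E M"
        using ex_maximum_matching[of ?E] finE by auto
      then have "matching E M" "v \<notin> \<Union>M"
        by (auto simp: maximum_matching_def matching_def)
      then show ?thesis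
        using v(2)[of M] M card_matching_le[OF finE, of M]
        by (fastforce simp: maximum_matching_def order_less_le)
    qed
    moreover have "?V - S = V - insert v S"
      by auto
    then have "odd_classes ?V S c = odd_classes V (insert v S) c"
      by (simp add: odd_classes_def)
    moreover have "barrier V E (insert v S) c"
      using S(1) v(1) by (auto simp: barrier_def)
    moreover have "card (insert v S) = Suc (card S)"
      using S(1) finV by (subst card_insert_disjoint) (auto simp: barrier_def intro: finite_subset)
    ultimately show ?thesis
      using S(2) cV by (intro exI[of _ "insert v S"] exI[of _ c]) auto
  qed
qed

section \<open>Counting edges\<close>

text \<open>
  Identifying the vertices with the same value under \<open>f\<close> leaves a connected graph on \<open>f ` V\<close>, whose
  edges come from the edges on which \<open>f\<close> is not constant.
\<close>

lemma card_classes_le_cross_edges: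
  fixes f :: "'a \<Rightarrow> 'b"
  assumes G: "connected_graph V E"
  shows "card (f ` V) \<le> Suc (card {e \<in> E. card (f ` e) = 2})"
proof -
  have sg: "simple_graph V E" and finV: "finite V" and "V \<noteq> {}"
    using G by (auto simp: connected_graph_def simple_graph_def)
  have finE: "finite E"
    using sg by (rule simple_graph_finite_edges)
  \<comment> \<open>A spanning tree of the quotient is grown: as long as \<open>L\<close> is not all of \<open>f ` V\<close>, some edge joins
    a vertex with value in \<open>L\<close> to one with value outside \<open>L\<close>.\<close>
  let ?X = "\<lambda>L. {e \<in> E. f ` e \<subseteq> L \<and> card (f ` e) = 2}"
  have "\<exists>L \<subseteq> f ` V. card L = Suc j \<and> card L \<le> Suc (card (?X L))" if "Suc j \<le> card (f ` V)" for j
    using that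
  proof (induction j)
    case 0
    obtain a where "a \<in> V"
      using \<open>V \<noteq> {}\<close> by auto
    then show ?case
      by (intro exI[of _ "{f a}"]) auto
  next
    case (Suc j)
    then obtain L where L: "L \<subseteq> f ` V" "card L = Suc j" "card L \<le> Suc (card (?X L))"
      by auto
    obtain a where a: "a \<in> V" "f a \<in> L"
      using L by (metis card.empty equals0I imageE nat.distinct(1) subset_iff)
    have "L \<noteq> f ` V"
      using L Suc.prems by auto
    then obtain b where b: "b \<in> V" "f b \<notin> L"
      using L by auto
    have "(a, b) \<in> (adj_rel E)\<^sup>*"
      using G a b by (auto simp: connected_graph_def)
    then have "\<exists>x y. {x, y} \<in> E \<and> f x \<in> L \<and> f y \<notin> L"
      using a(2) b(2) by (induction rule: rtrancl_induct) (auto simp: adj_rel_def)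
    then obtain x y where xy: "{x, y} \<in> E" "f x \<in> L" "f y \<notin> L"
      by auto
    have "y \<in> V"
      using xy sg by (auto simp: simple_graph_def)
    have "f x \<noteq> f y"
      using xy by auto
    then have "insert {x, y} (?X L) \<subseteq> ?X (insert (f y) L)"
      using xy by auto
    moreover have "{x, y} \<notin> ?X L"
      using xy by auto
    ultimately have "Suc (card (?X L)) \<le> card (?X (insert (f y) L))"
      using card_mono[of "?X (insert (f y) L)" "insert {x, y} (?X L)"] finE by auto
    moreover have "finite L"
      using L finV by (meson finite_imageI finite_subset)
    ultimately show ?case
      using L xy \<open>y \<in> V\<close> by (intro exI[of _ "insert (f y) L"]) auto
  qed
  from this[of "card (f ` V) - 1"] obtain L where L: "L \<subseteq> f ` V" "card L = card (f ` V)"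
    "card L \<le> Suc (card (?X L))"
    using finV \<open>V \<noteq> {}\<close> by (auto simp: card_gt_0_iff)
  moreover have "card (?X L) \<le> card {e \<in> E. card (f ` e) = 2}"
    using finE by (intro card_mono) auto
  ultimately show ?thesis
    by simp
qed

lemma handshake:
  assumes "finite E" "finite A"
  shows "(\<Sum>v\<in>A. vertex_degree E v) = (\<Sum>e\<in>E. card (e \<inter> A))"
proof -
  have "(\<Sum>v\<in>A. vertex_degree E v) = (\<Sum>v\<in>A. \<Sum>e\<in>E. if v \<in> e then 1 else 0)"
    using assms by (simp add: vertex_degree_def sum.If_cases Int_def)
  also have "\<dots> = (\<Sum>e\<in>E. \<Sum>v\<in>A. if v \<in> e then 1 else 0)"
    by (rule sum.swap)
  also have "\<dots> = (\<Sum>e\<in>E. card (e \<inter> A))"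
    using assms by (simp add: sum.If_cases Int_def conj_commute)
  finally show ?thesis .
qed

lemma sum_by_degree:
  fixes w :: "nat \<Rightarrow> nat"
  assumes "finite A" "\<And>v. v \<in> A \<Longrightarrow> vertex_degree E v \<le> 3"
  shows "(\<Sum>v\<in>A. w (vertex_degree E v)) =
    w 0 * num_degree A E 0 + w 1 * num_degree A E 1 +
    w 2 * num_degree A E 2 + w 3 * num_degree A E 3"
proof -
  have "(\<Sum>v\<in>A. w (vertex_degree E v)) =
      (\<Sum>i\<in>{..3}. \<Sum>v\<in>{v \<in> A. vertex_degree E v = i}. w (vertex_degree E v))"
    using assms by (intro sum.group[symmetric]) auto
  also have "\<dots> = (\<Sum>i\<in>{..3}. w i * num_degree A E i)"
    by (simp add: num_degree_def mult.commute)
  finally show ?thesis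
    by (simp add: numeral_eq_Suc)
qed

lemma card_edges_inside_le:
  assumes "simple_graph V E" "finite C"
  shows "2 * card {e \<in> E. e \<subseteq> C} \<le> card C * (card C - 1)"
proof -
  have "card {e \<in> E. e \<subseteq> C} \<le> card {e. e \<subseteq> C \<and> card e = 2}"
    using assms by (intro card_mono) (auto simp: simple_graph_def)
  also have "\<dots> = card C choose 2"
    using n_subsets[OF assms(2)] by simp
  finally show ?thesis
    by (simp add: choose_two)
qed

lemma incident_edges_le_sum_degree:
  assumes "finite E" "finite S"
  shows "card {e \<in> E. e \<inter> S \<noteq> {}} \<le> (\<Sum>v\<in>S. vertex_degree E v)"
proof -
  have "card {e \<in> E. e \<inter> S \<noteq> {}} = (\<Sum>e\<in>{e \<in> E. e \<inter> S \<noteq> {}}. 1)"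
    by simp
  also have "\<dots> \<le> (\<Sum>e\<in>{e \<in> E. e \<inter> S \<noteq> {}}. card (e \<inter> S))"
    using assms by (intro sum_mono) (auto simp: Suc_le_eq card_gt_0_iff)
  also have "\<dots> \<le> (\<Sum>e\<in>E. card (e \<inter> S))"
    using assms by (intro sum_mono2) auto
  finally show ?thesis
    using handshake[OF assms] by simp
qed

lemma edge_conv_pair:
  assumes "simple_graph V E" "e \<in> E" "a \<in> e"
  obtains b where "e = {a, b}" "a \<noteq> b" "a \<in> V" "b \<in> V"
proof -
  have "card e = 2" "e \<subseteq> V"
    using assms by (auto simp: simple_graph_def)
  then show ?thesis
    using that assms(3) by (auto simp: card_2_iff insert_commute)
qed

text \<open>The vertices outside \<open>S\<close> with label \<open>l\<close>.\<close>

definition class_of :: "'a set \<Rightarrow> 'a set \<Rightarrow> ('a \<Rightarrow> 'b) \<Rightarrow> 'b \<Rightarrow> 'a set" where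
  "class_of V S c l = {v \<in> V - S. c v = l}"

text \<open>The edges between \<open>C\<close> and \<open>S\<close>, where \<open>C\<close> is understood to be disjoint from \<open>S\<close>.\<close>

definition leaving :: "'a set set \<Rightarrow> 'a set \<Rightarrow> 'a set \<Rightarrow> 'a set set" where
  "leaving E S C = {e \<in> E. e \<inter> C \<noteq> {} \<and> e \<inter> S \<noteq> {}}"

lemma class_edge_cases:
  assumes "simple_graph V E" "barrier V E S c" "e \<in> E" "e \<inter> class_of V S c l \<noteq> {}"
  shows "e \<subseteq> class_of V S c l \<or> e \<inter> S \<noteq> {}"
proof -
  obtain a where a: "a \<in> e" "a \<in> class_of V S c l"
    using assms(4) by auto
  obtain b where "e = {a, b}" "b \<in> V"
    using edge_conv_pair[OF assms(1,3) a(1)] by metis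
  then show ?thesis
    using a assms(2,3) by (auto simp: class_of_def barrier_def)
qed

lemma card_edge_Int_class:
  assumes "simple_graph V E" "e \<in> leaving E S (class_of V S c l)"
  shows "card (e \<inter> class_of V S c l) = 1"
proof -
  have "e \<in> E"
    using assms(2) by (simp add: leaving_def)
  obtain a where a: "a \<in> e" "a \<in> class_of V S c l"
    using assms(2) by (auto simp: leaving_def)
  obtain b where "e = {a, b}"
    using edge_conv_pair[OF assms(1) \<open>e \<in> E\<close> a(1)] by metis
  then have "e \<inter> class_of V S c l = {a}"
    using a assms(2) by (auto simp: class_of_def leaving_def)
  then show ?thesis
    by simp
qed

lemma sum_degree_class:
  assumes G: "simple_graph V E" and B: "barrier V E S c"
  shows "(\<Sum>v\<in>class_of V S c l. vertex_degree E v) =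
    2 * card {e \<in> E. e \<subseteq> class_of V S c l} + card (leaving E S (class_of V S c l))"
    (is "_ = 2 * card ?I + card ?L")
proof -
  let ?C = "class_of V S c l"
  have fin: "finite E" "finite ?C"
    using G simple_graph_finite_edges by (auto simp: simple_graph_def class_of_def)
  have "(\<Sum>v\<in>?C. vertex_degree E v) = (\<Sum>e\<in>E. card (e \<inter> ?C))"
    using fin by (rule handshake)
  also have "\<dots> = (\<Sum>e\<in>?I \<union> ?L. card (e \<inter> ?C))"
  proof (rule sum.mono_neutral_right)
    show "\<forall>e\<in>E - (?I \<union> ?L). card (e \<inter> ?C) = 0"
    proof
      fix e assume "e \<in> E - (?I \<union> ?L)"
      then have "e \<inter> ?C = {}"
        using class_edge_cases[OF G B, of e l] by (auto simp: leaving_def)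
      then show "card (e \<inter> ?C) = 0"
        by simp
    qed
  qed (use fin in \<open>auto simp: leaving_def\<close>)
  also have "\<dots> = (\<Sum>e\<in>?I. card (e \<inter> ?C)) + (\<Sum>e\<in>?L. card (e \<inter> ?C))"
    using fin by (intro sum.union_disjoint) (auto simp: leaving_def class_of_def)
  also have "(\<Sum>e\<in>?L. card (e \<inter> ?C)) = (\<Sum>e\<in>?L. 1)"
    using card_edge_Int_class[OF G] by (intro sum.cong) auto
  also have "(\<Sum>e\<in>?I. card (e \<inter> ?C)) = (\<Sum>e\<in>?I. 2)"
    using G by (intro sum.cong) (auto simp: simple_graph_def Int_absorb2)
  finally show ?thesis
    by simp
qed

lemma sum_leaving_le:
  assumes G: "simple_graph V E" and "finite L"
  shows "(\<Sum>l\<in>L. card (leaving E S (class_of V S c l))) \<le> card {e \<in> E. e \<inter> S \<noteq> {}}"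
proof -
  have fin: "finite E"
    using G by (rule simple_graph_finite_edges)
  have disj: "leaving E S (class_of V S c l) \<inter> leaving E S (class_of V S c l') = {}"
    if "l \<noteq> l'" for l l'
  proof (rule ccontr)
    assume "\<not> ?thesis"
    then obtain e a b s where e: "e \<in> E" "a \<in> e" "b \<in> e" "s \<in> e" "s \<in> S"
      "a \<in> class_of V S c l" "b \<in> class_of V S c l'"
      by (auto simp: leaving_def)
    obtain t where "e = {s, t}"
      using edge_conv_pair[OF G e(1,4)] by metis
    then show False
      using e that by (auto simp: class_of_def)
  qed
  have "(\<Sum>l\<in>L. card (leaving E S (class_of V S c l))) =
      card (\<Union>l\<in>L. leaving E S (class_of V S c l))"
    using assms(2) fin disj
    by (intro card_UN_disjoint[symmetric]) (auto simp: leaving_def)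
  also have "\<dots> \<le> card {e \<in> E. e \<inter> S \<noteq> {}}"
    using fin by (intro card_mono) (auto simp: leaving_def)
  finally show ?thesis .
qed

lemma barrier_tree_bound:
  assumes G: "connected_graph V E" and B: "barrier V E S c"
  shows "card S + card (odd_classes V S c) \<le> Suc (card {e \<in> E. e \<inter> S \<noteq> {}})"
proof -
  have sg: "simple_graph V E" and finV: "finite V"
    using G by (auto simp: connected_graph_def simple_graph_def)
  have finE: "finite E" and "finite S"
    using simple_graph_finite_edges[OF sg] B finV by (auto simp: barrier_def intro: finite_subset)
  define f where "f v = (if v \<in> S then Inl v else Inr (c v))" for v
  have "f ` V = Inl ` S \<union> Inr ` c ` (V - S)"
    using B by (force simp: f_def barrier_def image_iff)
  then have "card (f ` V) = card S + card (c ` (V - S))"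
    using \<open>finite S\<close> finV by (simp, subst card_Un_disjoint) (force simp: card_image)+
  moreover have "card (odd_classes V S c) \<le> card (c ` (V - S))"
    using finV by (intro card_mono) (auto simp: odd_classes_def)
  moreover have "{e \<in> E. card (f ` e) = 2} \<subseteq> {e \<in> E. e \<inter> S \<noteq> {}}"
  proof clarify
    fix e assume e: "e \<in> E" "card (f ` e) = 2" "e \<inter> S = {}"
    then obtain a where a: "a \<in> e"
      by (metis card.empty ex_in_conv image_is_empty zero_neq_numeral)
    obtain b where b: "e = {a, b}"
      using edge_conv_pair[OF sg e(1) a] by metis
    then have "f a = f b"
      using e B by (auto simp: f_def barrier_def)
    then show False
      using e(2) b by simp
  qed
  then have "card {e \<in> E. card (f ` e) = 2} \<le> card {e \<in> E. e \<inter> S \<noteq> {}}"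
    using finE by (intro card_mono) auto
  ultimately show ?thesis
    using card_classes_le_cross_edges[OF G, of f] by linarith
qed

lemma isolated_class:
  assumes G: "connected_graph V E" and B: "barrier V E S c"
    and "class_of V S c l \<noteq> {}" "leaving E S (class_of V S c l) = {}"
  shows "class_of V S c l = V"
proof -
  have sg: "simple_graph V E"
    using G by (simp add: connected_graph_def)
  obtain u where u: "u \<in> class_of V S c l"
    using assms(3) by auto
  have "v \<in> class_of V S c l" if "v \<in> V" for v
  proof -
    have "u \<in> V"
      using u by (simp add: class_of_def)
    then have "(u, v) \<in> (adj_rel E)\<^sup>*"
      using that G by (simp add: connected_graph_def)
    then show ?thesis
    proof (induction rule: rtrancl_induct)
      case (step a b)
      then have "{a, b} \<in> E"
        by (simp add: adj_rel_def)
      then show ?case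
        using class_edge_cases[OF sg B, of "{a, b}" l] step.IH assms(4)
        by (auto simp: leaving_def)
    qed (rule u)
  qed
  then show ?thesis
    by (auto simp: class_of_def)
qed

section \<open>Weighted matching bounds\<close>

text \<open>
  The counting step. Every odd class demands \<open>q\<close>. One with \<open>k > 0\<close> edges to \<open>S\<close> can pay
  all but \<open>x + y k\<close> from the weights of its vertices. The missing \<open>x\<close> per class and \<open>y\<close> per edge are charged
  to the edges meeting \<open>S\<close>: by connectedness the number of classes is at most the number of these
  edges plus \<open>1 - |S|\<close>, so each of them is charged \<open>x + y\<close> altogether, and assumption \<open>removed\<close> says that
  a vertex of \<open>S\<close> can afford its edges, the summand \<open>x\<close> on the right being its share of the
  term \<open>- |S|\<close>. If a class has no edge to \<open>S\<close>, it is the whole graph and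
  \<open>z\<close> covers what is missing; otherwise \<open>z\<close> covers the extra \<open>x\<close> from the summand \<open>1\<close>.
\<close>

lemma weighted_odd_classes_bound:
  fixes w :: "nat \<Rightarrow> nat" and q x y z :: nat
  assumes G: "connected_graph V E" and cubic: "subcubic V E" and B: "barrier V E S c"
    and attached: "\<And>C. \<lbrakk>C \<subseteq> V; odd (card C); leaving E S C \<noteq> {};
        (\<Sum>v\<in>C. vertex_degree E v) = 2 * card {e \<in> E. e \<subseteq> C} + card (leaving E S C)\<rbrakk> \<Longrightarrow>
        q \<le> (\<Sum>v\<in>C. w (vertex_degree E v)) + x + y * card (leaving E S C)"
    and isolated: "\<lbrakk>odd (card V); (\<Sum>v\<in>V. vertex_degree E v) = 2 * card {e \<in> E. e \<subseteq> V}\<rbrakk> \<Longrightarrow>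
        q \<le> (\<Sum>v\<in>V. w (vertex_degree E v)) + z"
    and removed: "\<And>d. d \<le> 3 \<Longrightarrow> (x + y) * d \<le> q + w d + x"
    and "x \<le> z"
  shows "q * card (odd_classes V S c) \<le>
    (\<Sum>v\<in>V. w (vertex_degree E v)) + q * card S + z"
proof -
  have sg: "simple_graph V E" and finV: "finite V"
    using G by (auto simp: connected_graph_def simple_graph_def)
  have finE: "finite E" and SV: "S \<subseteq> V" and finS: "finite S"
    using simple_graph_finite_edges[OF sg] B finV by (auto simp: barrier_def intro: finite_subset)
  let ?O = "odd_classes V S c" and ?C = "class_of V S c"
  let ?w = "\<lambda>A. \<Sum>v\<in>A. w (vertex_degree E v)" and ?k = "\<lambda>l. card (leaving E S (?C l))"
  let ?T = "card {e \<in> E. e \<inter> S \<noteq> {}}"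
  have finO: "finite ?O"
    using finV by (simp add: odd_classes_def)
  have CV: "?C l \<subseteq> V" for l
    by (auto simp: class_of_def)
  have odd: "odd (card (?C l))" if "l \<in> ?O" for l
    using that by (simp add: odd_classes_def class_of_def)
  show ?thesis
  proof (cases "\<exists>l\<in>?O. leaving E S (?C l) = {}")
    case True
    then obtain l where l: "l \<in> ?O" "leaving E S (?C l) = {}"
      by auto
    have "?C l \<noteq> {}"
      using odd[OF l(1)] by force
    then have V: "?C l = V"
      using isolated_class[OF G B _ l(2)] by auto
    then have "?O = {l}"
      using l(1) by (auto simp: odd_classes_def class_of_def)
    moreover have "q \<le> ?w V + z"
      using isolated odd[OF l(1)] sum_degree_class[OF sg B, of l] l(2) V by simp
    ultimately show ?thesis
      by simp
  next
    case False
    have "q * card ?O = (\<Sum>l\<in>?O. q)"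
      by simp
    also have "\<dots> \<le> (\<Sum>l\<in>?O. ?w (?C l) + x + y * ?k l)"
      using attached[OF CV odd] False sum_degree_class[OF sg B]
      by (intro sum_mono) auto
    also have "\<dots> = (\<Sum>l\<in>?O. ?w (?C l)) + x * card ?O + y * (\<Sum>l\<in>?O. ?k l)"
      by (simp add: sum.distrib sum_distrib_left)
    also have "\<dots> \<le> (\<Sum>l\<in>?O. ?w (?C l)) + x * card ?O + y * ?T"
      using sum_leaving_le[OF sg finO] by simp
    finally have 1: "q * card ?O \<le> (\<Sum>l\<in>?O. ?w (?C l)) + x * card ?O + y * ?T" .
    have "x * (card S + card ?O) \<le> x * Suc ?T"
      using barrier_tree_bound[OF G B] by (rule mult_le_mono2)
    then have 2: "x * card S + x * card ?O \<le> x + x * ?T"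
      by (simp add: algebra_simps)
    have "(x + y) * ?T \<le> (x + y) * (\<Sum>v\<in>S. vertex_degree E v)"
      using incident_edges_le_sum_degree[OF finE finS] by (rule mult_le_mono2)
    also have "\<dots> = (\<Sum>v\<in>S. (x + y) * vertex_degree E v)"
      by (rule sum_distrib_left)
    also have "\<dots> \<le> (\<Sum>v\<in>S. q + w (vertex_degree E v) + x)"
      using removed cubic SV by (intro sum_mono) (auto simp: subcubic_def)
    also have "\<dots> = q * card S + ?w S + x * card S"
      by (simp add: sum.distrib)
    finally have 3: "x * ?T + y * ?T \<le> q * card S + ?w S + x * card S"
      by (simp add: algebra_simps)
    have "(\<Sum>l\<in>?O. ?w (?C l)) = ?w (\<Union>l\<in>?O. ?C l)"
      using finO finV by (intro sum.UNION_disjoint[symmetric]) (auto simp: class_of_def)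
    moreover have "?w S + ?w (\<Union>l\<in>?O. ?C l) = ?w (S \<union> (\<Union>l\<in>?O. ?C l))"
      using finO finV finS by (intro sum.union_disjoint[symmetric]) (auto simp: class_of_def)
    moreover have "\<dots> \<le> ?w V"
      using finV SV by (intro sum_mono2) (auto simp: class_of_def)
    ultimately have "?w S + (\<Sum>l\<in>?O. ?w (?C l)) \<le> ?w V"
      by simp
    then show ?thesis
      using 1 2 3 \<open>x \<le> z\<close> by linarith
  qed
qed

text \<open>
  The same with weights \<open>w0, w1, w2, w3\<close> for the degrees \<open>0, 1, 2, 3\<close>. In the assumptions, \<open>N\<close> is the
  number of vertices of an odd class, \<open>ai\<close> of which have degree \<open>i\<close> in the whole graph, \<open>m\<close> is the
  number of edges inside the class, and \<open>k\<close> the number of edges from it to \<open>S\<close>.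
\<close>

lemma weighted_matching_bound:
  fixes w0 w1 w2 w3 q x y z :: nat
  assumes G: "connected_graph V E" and cubic: "subcubic V E"
    and attached: "\<And>a0 a1 a2 a3 m k N. \<lbrakk>N = a0 + a1 + a2 + a3; odd N; a1 + 2 * a2 + 3 * a3 = 2 * m + k;
        2 * m \<le> N * (N - 1); 0 < k\<rbrakk> \<Longrightarrow>
        q \<le> w0 * a0 + w1 * a1 + w2 * a2 + w3 * a3 + x + y * k"
    and isolated: "\<And>a0 a1 a2 a3 m N. \<lbrakk>N = a0 + a1 + a2 + a3; odd N; a1 + 2 * a2 + 3 * a3 = 2 * m;
        2 * m \<le> N * (N - 1)\<rbrakk> \<Longrightarrow>
        q \<le> w0 * a0 + w1 * a1 + w2 * a2 + w3 * a3 + z"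
    and removed: "y \<le> q + w1" "x + 2 * y \<le> q + w2" "2 * x + 3 * y \<le> q + w3"
    and "x \<le> z"
  shows "q * card V \<le> 2 * q * matching_number E + w0 * num_degree V E 0 + w1 * num_degree V E 1
    + w2 * num_degree V E 2 + w3 * num_degree V E 3 + z"
proof -
  have sg: "simple_graph V E" and finV: "finite V"
    using G by (auto simp: connected_graph_def simple_graph_def)
  obtain S and c :: "'a \<Rightarrow> 'a set" where B: "barrier V E S c"
    and def: "card V + card S \<le> 2 * matching_number E + card (odd_classes V S c)"
    using tutte_berge_barrier[OF sg] by auto
  define w where "w d = (if d = 0 then w0 else if d = 1 then w1 else if d = 2 then w2 else w3)"
    for d :: nat
  have wsum: "(\<Sum>v\<in>A. w (vertex_degree E v)) = w0 * num_degree A E 0 + w1 * num_degree A E 1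
      + w2 * num_degree A E 2 + w3 * num_degree A E 3" if "A \<subseteq> V" for A
    using sum_by_degree[of A E w] that cubic finV
    by (auto simp: w_def subcubic_def intro: finite_subset)
  have dsum: "(\<Sum>v\<in>A. vertex_degree E v) =
      num_degree A E 1 + 2 * num_degree A E 2 + 3 * num_degree A E 3" if "A \<subseteq> V" for A
    using sum_by_degree[of A E "\<lambda>d. d"] that cubic finV
    by (auto simp: subcubic_def intro: finite_subset)
  have csum: "card A = num_degree A E 0 + num_degree A E 1 + num_degree A E 2 + num_degree A E 3"
    if "A \<subseteq> V" for A
    using sum_by_degree[of A E "\<lambda>d. 1"] that cubic finV
    by (auto simp: subcubic_def intro: finite_subset)
  have inside: "2 * card {e \<in> E. e \<subseteq> A} \<le> card A * (card A - 1)" if "A \<subseteq> V" for A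
    using card_edges_inside_le[OF sg] that finV by (auto intro: finite_subset)
  have "q * card (odd_classes V S c) \<le>
      (\<Sum>v\<in>V. w (vertex_degree E v)) + q * card S + z"
  proof (rule weighted_odd_classes_bound[OF G cubic B, where x = x and y = y])
    fix C assume C: "C \<subseteq> V" "odd (card C)" "leaving E S C \<noteq> {}"
      "(\<Sum>v\<in>C. vertex_degree E v) = 2 * card {e \<in> E. e \<subseteq> C} + card (leaving E S C)"
    have "0 < card (leaving E S C)"
      using C(3) simple_graph_finite_edges[OF sg] by (simp add: card_gt_0_iff leaving_def)
    then show "q \<le> (\<Sum>v\<in>C. w (vertex_degree E v)) + x + y * card (leaving E S C)"
      unfolding wsum[OF C(1)]
      using attached[OF csum[OF C(1)] C(2) _ inside[OF C(1)]] C(4) dsum[OF C(1)] by simp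
  next
    assume "odd (card V)" "(\<Sum>v\<in>V. vertex_degree E v) = 2 * card {e \<in> E. e \<subseteq> V}"
    then show "q \<le> (\<Sum>v\<in>V. w (vertex_degree E v)) + z"
      unfolding wsum[OF order_refl]
      using isolated[OF csum _ _ inside] dsum[of V] by simp
  next
    fix d :: nat assume "d \<le> 3"
    then have "d = 0 \<or> d = 1 \<or> d = 2 \<or> d = 3"
      by auto
    then show "(x + y) * d \<le> q + w d + x"
      using removed by (auto simp: w_def)
  qed (rule \<open>x \<le> z\<close>)
  moreover have "q * card V + q * card S \<le> q * (2 * matching_number E) + q * card (odd_classes V S c)"
    using mult_le_mono2[OF def, of q] by (simp add: algebra_simps)
  ultimately show ?thesis
    by (simp add: wsum[OF order_refl])
qed

lemma odd_cases_small:
  fixes N :: nat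
  assumes "odd N"
  obtains "N = 1" | "N = 3" | "N \<ge> 5"
proof -
  have "N = 1 \<or> N = 3 \<or> N \<ge> 5"
    using assms by presburger
  then show ?thesis
    using that by blast
qed

text \<open>
  The sum of the degrees is even in a component not joined to \<open>S\<close>; so if its order is odd, not all
  of its vertices have degree three.
\<close>

lemma odd_not_all_cubic:
  fixes a0 a1 a2 a3 m :: nat
  assumes "odd (a0 + a1 + a2 + a3)" "a1 + 2 * a2 + 3 * a3 = 2 * m"
  shows "0 < a0 + a1 + a2"
proof (rule ccontr)
  assume "\<not> ?thesis"
  then have "odd a3" "3 * a3 = 2 * m"
    using assms by auto
  then show False
    by presburger
qed

lemma card_by_degree:
  assumes "finite V" "subcubic V E"
  shows "card V = num_degree V E 0 + num_degree V E 1 + num_degree V E 2 + num_degree V E 3"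
  using sum_by_degree[of V E "\<lambda>d. 1"] assms by (auto simp: subcubic_def)

text \<open>
  In the next three lemmas the weight of degree \<open>i\<close> is \<open>q - 2 q \<cdot> x\<^sub>i\<close>, where \<open>x\<^sub>i\<close> is the
  coefficient of \<open>n\<^sub>i\<close> at the polytope vertex in question (with \<open>x\<^sub>0 = 0\<close>), and \<open>q\<close> clears the denominators.
\<close>

lemma matching_bound_4_3_2:
  assumes G: "connected_graph V E" and cubic: "subcubic V E"
  shows "4 * num_degree V E 3 + 3 * num_degree V E 2 + 2 * num_degree V E 1
    \<le> 9 * matching_number E + 1"
proof -
  have "9 * card V \<le> 2 * 9 * matching_number E + 9 * num_degree V E 0 + 5 * num_degree V E 1
    + 3 * num_degree V E 2 + 1 * num_degree V E 3 + 2"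
  proof (rule weighted_matching_bound[OF G cubic, where x = 2 and y = 2])
    fix a0 a1 a2 a3 m k N :: nat
    assume N: "N = a0 + a1 + a2 + a3" "odd N" "a1 + 2 * a2 + 3 * a3 = 2 * m + k"
      "2 * m \<le> N * (N - 1)" "0 < k"
    from N(2) show "9 \<le> 9 * a0 + 5 * a1 + 3 * a2 + 1 * a3 + 2 + 2 * k"
      by (cases rule: odd_cases_small) (use N in auto)
  next
    fix a0 a1 a2 a3 m N :: nat
    assume N: "N = a0 + a1 + a2 + a3" "odd N" "a1 + 2 * a2 + 3 * a3 = 2 * m"
      "2 * m \<le> N * (N - 1)"
    from N(2) show "9 \<le> 9 * a0 + 5 * a1 + 3 * a2 + 1 * a3 + 2"
    proof (cases rule: odd_cases_small)
      case 3
      then show ?thesis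
        using odd_not_all_cubic[of a0 a1 a2 a3 m] N(1-3) by auto
    qed (use N in auto)
  qed auto
  then show ?thesis
    using card_by_degree[OF _ cubic] G
    by (simp add: connected_graph_def simple_graph_def)
qed

lemma matching_bound_7_6_3:
  assumes G: "connected_graph V E" and cubic: "subcubic V E"
  shows "7 * num_degree V E 3 + 6 * num_degree V E 2 + 3 * num_degree V E 1
    \<le> 16 * matching_number E + 2"
proof -
  have "8 * card V \<le> 2 * 8 * matching_number E + 8 * num_degree V E 0 + 5 * num_degree V E 1
    + 2 * num_degree V E 2 + 1 * num_degree V E 3 + 2"
  proof (rule weighted_matching_bound[OF G cubic, where x = 0 and y = 3])
    fix a0 a1 a2 a3 m k N :: nat
    assume N: "N = a0 + a1 + a2 + a3" "odd N" "a1 + 2 * a2 + 3 * a3 = 2 * m + k"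
      "2 * m \<le> N * (N - 1)" "0 < k"
    from N(2) show "8 \<le> 8 * a0 + 5 * a1 + 2 * a2 + 1 * a3 + 0 + 3 * k"
      by (cases rule: odd_cases_small) (use N in auto)
  next
    fix a0 a1 a2 a3 m N :: nat
    assume N: "N = a0 + a1 + a2 + a3" "odd N" "a1 + 2 * a2 + 3 * a3 = 2 * m"
      "2 * m \<le> N * (N - 1)"
    from N(2) show "8 \<le> 8 * a0 + 5 * a1 + 2 * a2 + 1 * a3 + 2"
    proof (cases rule: odd_cases_small)
      case 3
      then show ?thesis
        using odd_not_all_cubic[of a0 a1 a2 a3 m] N(1-3) by auto
    qed (use N in auto)
  qed auto
  then show ?thesis
    using card_by_degree[OF _ cubic] G
    by (simp add: connected_graph_def simple_graph_def)
qed

lemma matching_bound_1_2_1: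
  assumes G: "connected_graph V E" and cubic: "subcubic V E"
  shows "num_degree V E 3 + 2 * num_degree V E 2 + num_degree V E 1 \<le> 4 * matching_number E + 2"
proof -
  have "2 * card V \<le> 2 * 2 * matching_number E + 2 * num_degree V E 0 + 1 * num_degree V E 1
    + 0 * num_degree V E 2 + 1 * num_degree V E 3 + 2"
  proof (rule weighted_matching_bound[OF G cubic, where x = 0 and y = 1])
    fix a0 a1 a2 a3 m k N :: nat
    assume N: "a1 + 2 * a2 + 3 * a3 = 2 * m + k" "0 < k"
    show "2 \<le> 2 * a0 + 1 * a1 + 0 * a2 + 1 * a3 + 0 + 1 * k"
    proof (cases "k = 1")
      case True
      then have "odd (a1 + 2 * a2 + 3 * a3)"
        using N by simp
      then have "0 < a1 + a3"
        by (auto intro: Nat.gr0I)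
      then show ?thesis
        using True by linarith
    qed (use N in auto)
  qed auto
  then show ?thesis
    using card_by_degree[OF _ cubic] G
    by (simp add: connected_graph_def simple_graph_def)
qed

lemma num_leaves_le:
  assumes G: "connected_graph V E" and cubic: "subcubic V E"
  shows "num_degree V E 1 \<le> num_degree V E 3 + 2"
proof -
  have sg: "simple_graph V E" and finV: "finite V"
    using G by (auto simp: connected_graph_def simple_graph_def)
  have finE: "finite E"
    using sg by (rule simple_graph_finite_edges)
  have "card V \<le> Suc (card {e \<in> E. card e = 2})"
    using card_classes_le_cross_edges[OF G, of "\<lambda>v. v"] by simp
  also have "\<dots> \<le> Suc (card E)"
    using finE by (auto intro: card_mono)
  finally have "card V \<le> Suc (card E)" .
  moreover have "(\<Sum>e\<in>E. card (e \<inter> V)) = (\<Sum>e\<in>E. 2)"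
    using sg by (intro sum.cong) (auto simp: simple_graph_def Int_absorb2)
  then have "2 * card E = (\<Sum>v\<in>V. vertex_degree E v)"
    using handshake[OF finE finV] by simp
  moreover have "\<dots> = num_degree V E 1 + 2 * num_degree V E 2 + 3 * num_degree V E 3"
    using sum_by_degree[OF finV, of E "\<lambda>d. d"] cubic by (simp add: subcubic_def)
  ultimately show ?thesis
    using card_by_degree[OF finV cubic] by linarith
qed

section \<open>The polytope\<close>

text \<open>An affine function on an interval is bounded by its values at the two ends.\<close>

lemma affine_le_between:
  fixes p r s t K :: real
  assumes "s \<le> x" "x \<le> t" "p + s * r \<le> K" "p + t * r \<le> K"
  shows "p + x * r \<le> K"
proof (cases "r \<ge> 0")
  case True
  then have "x * r \<le> t * r"
    using assms by (intro mult_right_mono)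
  then show ?thesis
    using assms by linarith
next
  case False
  then have "x * r \<le> s * r"
    using assms by (intro mult_right_mono_neg) auto
  then show ?thesis
    using assms by linarith
qed

text \<open>
  For given \<open>a\<close> and \<open>b\<close> the constraints allow \<open>c\<close> up to \<open>2/3 - a\<close> if \<open>b \<le> 1/3\<close> and up to \<open>1 - a - b\<close>
  otherwise, and with this \<open>c\<close> the left-hand side is affine in \<open>a\<close> and in \<open>b\<close>. It therefore
  suffices to consider \<open>a = 0\<close> and the largest \<open>a\<close> that \<open>b\<close> permits, and then the break points
  \<open>1/3, 3/8, 1/2\<close> of \<open>b\<close>.
\<close>

lemma polyP_bound_nonneg:
  fixes a b c n1 n2 n3 \<nu> :: real
  assumes P: "(a, b, c) \<in> polyP" and "a \<ge> 0"
    and n: "n1 \<ge> 0" "n2 \<ge> 0" "n3 \<ge> 0"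
    and A: "4 * n3 + 3 * n2 + 2 * n1 \<le> 9 * \<nu> + 1"
    and B: "7 * n3 + 6 * n2 + 3 * n1 \<le> 16 * \<nu> + 2"
    and C: "n3 + 2 * n2 + n1 \<le> 4 * \<nu> + 2"
    and L: "n1 \<le> n3 + 2"
  shows "a * n3 + b * n2 + c * n1 \<le> \<nu> + 1"
proof -
  have ineq: "a \<le> 4/9" "b \<le> 1/2" "a + c \<le> 2/3" "a + 3/2 * b \<le> 1" "a + b + c \<le> 1"
    "a + 1/6 * b \<le> 1/2"
    using P by (auto simp: polyP_def)
  show ?thesis
  proof (cases "b \<le> 1/3")
    case True
    have "(1/3 * n2 + 2/3 * n1) + a * (n3 - n1) \<le> \<nu> + 1"
      using \<open>a \<ge> 0\<close> ineq(1) by (rule affine_le_between) (use A L in \<open>simp_all add: field_simps\<close>)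
    moreover have "b * n2 \<le> 1/3 * n2"
      using True n by (intro mult_right_mono)
    moreover have "c * n1 \<le> (2/3 - a) * n1"
      using ineq n by (intro mult_right_mono) auto
    ultimately show ?thesis
      by (simp add: algebra_simps)
  next
    case False
    define t where "t = (if b \<le> 3/8 then 1/2 - 1/6 * b else 1 - 3/2 * b)"
    have "(n1 + b * (n2 - n1)) + 0 * (n3 - n1) \<le> \<nu> + 1"
      using False ineq(2) affine_le_between[of "1/3" b "1/2" n1 "n2 - n1" "\<nu> + 1"] A C L by argo
    moreover have "(n1 + b * (n2 - n1)) + t * (n3 - n1) \<le> \<nu> + 1"
    proof (cases "b \<le> 3/8")
      case True
      have "(1/2 * n1 + 1/2 * n3) + b * (n2 - 5/6 * n1 - 1/6 * n3) \<le> \<nu> + 1"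
        by (rule affine_le_between[of "1/3" b "3/8"]) (use False True A B in \<open>simp_all add: field_simps\<close>)
      then show ?thesis
        using True by (simp add: t_def field_simps)
    next
      case b: False
      have "n3 + b * (n2 + 1/2 * n1 - 3/2 * n3) \<le> \<nu> + 1"
        by (rule affine_le_between[of "3/8" b "1/2"]) (use b ineq(2) B C in \<open>simp_all add: field_simps\<close>)
      then show ?thesis
        using b by (simp add: t_def field_simps)
    qed
    moreover have "a \<le> t"
      using ineq by (auto simp: t_def)
    ultimately have "(n1 + b * (n2 - n1)) + a * (n3 - n1) \<le> \<nu> + 1"
      using \<open>a \<ge> 0\<close> affine_le_between[of 0 a t] by metis
    moreover have "c * n1 \<le> (1 - a - b) * n1"
      using ineq n by (intro mult_right_mono) auto
    ultimately show ?thesis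
      by (simp add: algebra_simps)
  qed
qed

theorem corollary4:
  fixes \<alpha> \<beta> \<gamma> :: real
  assumes "(\<alpha>, \<beta>, \<gamma>) \<in> polyP"
  shows "(\<alpha> \<ge> 0 \<longrightarrow>
           (\<forall>(V :: 'a set) E. connected_graph V E \<and> subcubic V E \<longrightarrow>
              real (matching_number E) \<ge>
                \<alpha> * real (num_degree V E 3) + \<beta> * real (num_degree V E 2)
                + \<gamma> * real (num_degree V E 1) - 1)) \<and>
         (\<alpha> < 0 \<longrightarrow>
           (\<forall>(V :: 'a set) E. connected_graph V E \<and> subcubic V E \<longrightarrow>
              real (matching_number E) \<ge>
                \<alpha> * real (num_degree V E 3) + \<beta> * real (num_degree V E 2)
                + \<gamma> * real (num_degree V E 1) - (2 * \<bar>\<alpha>\<bar> + 1)))"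
proof -
  have bound: "a * real (num_degree V E 3) + b * real (num_degree V E 2)
      + c * real (num_degree V E 1) \<le> real (matching_number E) + 1"
    if G: "connected_graph V E" "subcubic V E" and P: "(a, b, c) \<in> polyP" "a \<ge> 0"
    for V :: "'a set" and E a b c
    using matching_bound_4_3_2[OF G] matching_bound_7_6_3[OF G] matching_bound_1_2_1[OF G] num_leaves_le[OF G]
    by (intro polyP_bound_nonneg[OF P]) linarith+
  show ?thesis
  proof (intro conjI impI allI; elim conjE)
    fix V :: "'a set" and E
    assume "\<alpha> \<ge> 0" and G: "connected_graph V E" "subcubic V E"
    then show "real (matching_number E) \<ge>
        \<alpha> * real (num_degree V E 3) + \<beta> * real (num_degree V E 2)
        + \<gamma> * real (num_degree V E 1) - 1"
      using bound[OF G assms] by linarith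
  next
    fix V :: "'a set" and E
    assume neg: "\<alpha> < 0" and G: "connected_graph V E" "subcubic V E"
    have "(0, \<beta>, \<gamma> + \<alpha>) \<in> polyP"
      using assms by (auto simp: polyP_def)
    then have "\<beta> * real (num_degree V E 2) + (\<gamma> + \<alpha>) * real (num_degree V E 1)
        \<le> real (matching_number E) + 1"
      using bound[OF G, of 0] by simp
    moreover have "real (num_degree V E 1) - real (num_degree V E 3) \<le> 2"
      using num_leaves_le[OF G] by linarith
    then have "- \<alpha> * (real (num_degree V E 1) - real (num_degree V E 3)) \<le> - \<alpha> * 2"
      using neg by (intro mult_left_mono) auto
    ultimately show "real (matching_number E) \<ge>
        \<alpha> * real (num_degree V E 3) + \<beta> * real (num_degree V E 2)
        + \<gamma> * real (num_degree V E 1) - (2 * \<bar>\<alpha>\<bar> + 1)"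
      using neg by (simp add: algebra_simps)
  qed
qed

end
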